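(* Let $\mathcal{A}:\mathbb{S}^n\to\mathbb{R}^m$ be a surjective linear map and $b\in\mathbb{R}^m$, and suppose that $\mathcal{F}=\{X\in\mathbb{S}^n_+ : \mathcal{A}(X)=b\}$ is non-empty, bounded and contained in a proper face of $\mathbb{S}^n_+$. For $\alpha>0$ let $b(\alpha)=b+\alpha\mathcal{A}(I)$ and $\mathcal{F}(\alpha)=\{X\in\mathbb{S}^n_+ : \mathcal{A}(X)=b(\alpha)\}$. Then for every $\alpha>0$ there exists a unique $X(\alpha)\in\mathcal{F}(\alpha)\cap\mathbb{S}^n_{++}$ such that $$X(\alpha)=\arg\max\{\log\det(X): X\in\mathcal{F}(\alpha)\}.\qquad( * )$$ Moreover, $X(\alpha)$ satisfies $( * )$ if and only if there exist a unique $y(\alpha)\in\mathbb{R}^m$ and a unique $Z(\alpha)\in\mathbb{S}^n_{++}$ such that $$\mathcal{A}^*(y(\alpha))-Z(\alpha)=0,\qquad \mathcal{A}(X(\alpha))-b(\alpha)=0,\qquad Z(\alpha)X(\alpha)-I=0.$$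
   Context: $\mathbb{S}^n$ is the space of real symmetric $n\times n$ matrices with inner product $\langle X,Y\rangle=\operatorname{trace}(XY)$; $\mathbb{S}^n_+$ and $\mathbb{S}^n_{++}$ are the sets of positive semidefinite and positive definite matrices. $\mathcal{A}^*$ is the adjoint of $\mathcal{A}$. $\log\det$ is treated as an extended-valued concave function taking the value $-\infty$ at singular positive semidefinite $X$. A closed convex cone $f\subseteq\mathbb{S}^n_+$ is a face of $\mathbb{S}^n_+$ if $X,Y\in\mathbb{S}^n_+$ and $X+Y\in f$ imply $X,Y\in f$; it is proper if $f\ne\mathbb{S}^n_+$ and $f\neq 0$. *)

theory Defs
  imports "HOL-Analysis.Analysis"
begin

typedef 'n sym_matrix = "{X :: real^'n^'n::finite. transpose X = X}"
  morphisms matrix_of Sym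
  by (intro exI[of _ 0]) (simp add: transpose_def vec_eq_iff)

setup_lifting type_definition_sym_matrix

lemma transpose_matrix_of [simp]: "transpose (matrix_of X) = matrix_of X"
  using matrix_of by blast

instantiation sym_matrix :: (finite) real_vector
begin

lift_definition zero_sym_matrix :: "'a sym_matrix" is 0
  by (simp add: transpose_def vec_eq_iff)

lift_definition plus_sym_matrix :: "'a sym_matrix \<Rightarrow> 'a sym_matrix \<Rightarrow> 'a sym_matrix" is "(+)"
  by (simp add: transpose_def vec_eq_iff)

lift_definition minus_sym_matrix :: "'a sym_matrix \<Rightarrow> 'a sym_matrix \<Rightarrow> 'a sym_matrix" is "(-)"
  by (simp add: transpose_def vec_eq_iff)

lift_definition uminus_sym_matrix :: "'a sym_matrix \<Rightarrow> 'a sym_matrix" is uminus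
  by (simp add: transpose_def vec_eq_iff)

lift_definition scaleR_sym_matrix :: "real \<Rightarrow> 'a sym_matrix \<Rightarrow> 'a sym_matrix" is scaleR
  by (simp add: transpose_def vec_eq_iff)

instance
  by standard (transfer; simp add: algebra_simps)+

end

lemma trace_mult_symmetric:
  fixes X Y :: "real^'n^'n"
  assumes "transpose Y = Y"
  shows "trace (X ** Y) = X \<bullet> Y"
proof -
  have "Y $ k $ i = Y $ i $ k" for i k
    using assms by (metis transpose_def vec_lambda_beta)
  then show ?thesis
    by (simp add: trace_def matrix_matrix_mult_def inner_vec_def)
qed

instantiation sym_matrix :: (finite) real_inner
begin

definition inner_sym_matrix :: "'a sym_matrix \<Rightarrow> 'a sym_matrix \<Rightarrow> real" where
  "X \<bullet> Y = trace (matrix_of X ** matrix_of Y)"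

definition norm_sym_matrix :: "'a sym_matrix \<Rightarrow> real" where
  "norm (X::'a sym_matrix) = sqrt (X \<bullet> X)"

definition dist_sym_matrix :: "'a sym_matrix \<Rightarrow> 'a sym_matrix \<Rightarrow> real" where
  "dist X (Y::'a sym_matrix) = norm (X - Y)"

definition sgn_sym_matrix :: "'a sym_matrix \<Rightarrow> 'a sym_matrix" where
  "sgn (X::'a sym_matrix) = inverse (norm X) *\<^sub>R X"

definition uniformity_sym_matrix :: "('a sym_matrix \<times> 'a sym_matrix) filter" where
  "uniformity = (INF e\<in>{0<..}. principal {(X::'a sym_matrix, Y). dist X Y < e})"

definition open_sym_matrix :: "'a sym_matrix set \<Rightarrow> bool" where
  "open (U::'a sym_matrix set) \<longleftrightarrow> (\<forall>X\<in>U. eventually (\<lambda>(X', Y). X' = X \<longrightarrow> Y \<in> U) uniformity)"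

instance
proof
  fix X Y Z :: "'a sym_matrix" and r :: real and U :: "'a sym_matrix set"
  have *: "A \<bullet> B = matrix_of A \<bullet> matrix_of B" for A B :: "'a sym_matrix"
    unfolding inner_sym_matrix_def by (rule trace_mult_symmetric) simp
  show "dist X Y = norm (X - Y)"
    by (rule dist_sym_matrix_def)
  show "sgn X = inverse (norm X) *\<^sub>R X"
    by (rule sgn_sym_matrix_def)
  show "uniformity = (INF e\<in>{0<..}. principal {(X, Y::'a sym_matrix). dist X Y < e})"
    by (rule uniformity_sym_matrix_def)
  show "open U \<longleftrightarrow> (\<forall>X\<in>U. eventually (\<lambda>(X', Y). X' = X \<longrightarrow> Y \<in> U) uniformity)"
    by (rule open_sym_matrix_def)
  show "X \<bullet> Y = Y \<bullet> X"
    by (simp add: * inner_commute)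
  show "(X + Y) \<bullet> Z = X \<bullet> Z + Y \<bullet> Z"
    by (simp add: * plus_sym_matrix.rep_eq inner_add_left)
  show "(r *\<^sub>R X) \<bullet> Y = r * (X \<bullet> Y)"
    by (simp add: * scaleR_sym_matrix.rep_eq)
  show "0 \<le> X \<bullet> X"
    by (simp add: *)
  show "X \<bullet> X = 0 \<longleftrightarrow> X = 0"
    by (simp add: * zero_sym_matrix.rep_eq flip: matrix_of_inject)
  show "norm X = sqrt (X \<bullet> X)"
    by (rule norm_sym_matrix_def)
qed

end

lemma inner_matrix_of: "X \<bullet> Y = matrix_of X \<bullet> matrix_of Y"
  unfolding inner_sym_matrix_def by (rule trace_mult_symmetric) simp

lift_definition sym_id :: "'n::finite sym_matrix" is "mat 1"
  by (rule transpose_mat)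

lemma sym_matrix_orthonormal_basis:
  "\<exists>B :: 'n::finite sym_matrix set. B \<noteq> {} \<and> finite B
     \<and> (\<forall>u\<in>B. \<forall>v\<in>B. u \<bullet> v = (if u = v then 1 else 0))
     \<and> (\<forall>X. (\<forall>u\<in>B. X \<bullet> u = 0) \<longleftrightarrow> X = 0)"
proof -
  let ?S = "range (matrix_of :: 'n sym_matrix \<Rightarrow> real^'n^'n)"
  have sub: "subspace ?S"
  proof (rule subspaceI)
    show "0 \<in> ?S" by (auto simp flip: zero_sym_matrix.rep_eq)
    show "x + y \<in> ?S" if "x \<in> ?S" "y \<in> ?S" for x y
      using that by (auto simp flip: plus_sym_matrix.rep_eq)
    show "c *\<^sub>R x \<in> ?S" if "x \<in> ?S" for c x
      using that by (auto simp flip: scaleR_sym_matrix.rep_eq)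
  qed
  obtain C where C: "C \<subseteq> ?S" "pairwise orthogonal C" "\<And>x. x \<in> C \<Longrightarrow> norm x = 1"
      "independent C" "span C = ?S"
    using orthonormal_basis_subspace[OF sub] by metis
  define B :: "'n sym_matrix set" where "B = matrix_of -` C"
  have C_eq: "C = matrix_of ` B" using C(1) unfolding B_def by auto
  have "finite B"
    using independent_imp_finite[OF C(4)] unfolding B_def
    by (rule finite_vimageI) (simp add: inj_def matrix_of_inject)
  moreover have "u \<bullet> v = (if u = v then 1 else 0)" if "u \<in> B" "v \<in> B" for u v
  proof (cases "u = v")
    case True
    then show ?thesis using C(3)[of "matrix_of u"] that
      by (simp add: inner_matrix_of B_def norm_eq_1)
  next
    case False
    then show ?thesis using C(2) that
      by (auto simp: inner_matrix_of B_def pairwise_def orthogonal_def matrix_of_inject)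
  qed
  moreover have zero: "X = 0" if "\<forall>u\<in>B. X \<bullet> u = 0" for X
  proof -
    have "orthogonal (matrix_of X) y" if "y \<in> span C" for y
      using \<open>\<forall>u\<in>B. X \<bullet> u = 0\<close> that
      by (intro orthogonal_to_span[OF that]) (auto simp: C_eq orthogonal_def inner_matrix_of)
    then have "matrix_of X \<bullet> matrix_of X = 0" by (simp add: C(5) orthogonal_def)
    then show ?thesis by (simp flip: inner_matrix_of)
  qed
  moreover have "B \<noteq> {}"
  proof
    assume "B = {}"
    then have "(sym_id :: 'n sym_matrix) = 0" using zero[of sym_id] by simp
    then have "(mat 1 :: real^'n^'n) = 0" by (metis sym_id.rep_eq zero_sym_matrix.rep_eq)
    then have "trace (mat 1 :: real^'n^'n) = 0" by (simp add: trace_def)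
    then show False by (simp add: trace_I)
  qed
  moreover have "(\<forall>u\<in>B. X \<bullet> u = 0) \<longleftrightarrow> X = 0" for X
    using zero[of X] by (metis inner_zero_left)
  ultimately show ?thesis by blast
qed

text \<open>No particular basis is fixed; the instance provides finite dimensionality, without which
  the existence of \<^const>\<open>adjoint\<close> is not available.\<close>

instantiation sym_matrix :: (finite) euclidean_space
begin

definition Basis_sym_matrix :: "'a sym_matrix set" where
  "Basis = (SOME B :: 'a sym_matrix set. B \<noteq> {} \<and> finite B
     \<and> (\<forall>u\<in>B. \<forall>v\<in>B. u \<bullet> v = (if u = v then 1 else 0))
     \<and> (\<forall>X. (\<forall>u\<in>B. X \<bullet> u = 0) \<longleftrightarrow> X = 0))"

instance
proof
  have B: "Basis \<noteq> ({} :: 'a sym_matrix set) \<and> finite (Basis :: 'a sym_matrix set)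
     \<and> (\<forall>u\<in>Basis. \<forall>v\<in>Basis :: 'a sym_matrix set. u \<bullet> v = (if u = v then 1 else 0))
     \<and> (\<forall>X :: 'a sym_matrix. (\<forall>u\<in>Basis. X \<bullet> u = 0) \<longleftrightarrow> X = 0)"
    unfolding Basis_sym_matrix_def by (rule someI_ex) (rule sym_matrix_orthonormal_basis)
  show "(Basis :: 'a sym_matrix set) \<noteq> {}"
    by (rule conjunct1[OF B])
  show "finite (Basis :: 'a sym_matrix set)"
    by (rule conjunct1[OF conjunct2[OF B]])
  show "u \<bullet> v = (if u = v then 1 else 0)" if "u \<in> Basis" "v \<in> Basis" for u v :: "'a sym_matrix"
    using conjunct1[OF conjunct2[OF conjunct2[OF B]]] that by simp
  show "(\<forall>u\<in>Basis. X \<bullet> u = 0) \<longleftrightarrow> X = 0" for X :: "'a sym_matrix"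
    by (rule spec[OF conjunct2[OF conjunct2[OF conjunct2[OF B]]]])
qed

end

definition psd :: "'n::finite sym_matrix set" where
  "psd = {X. \<forall>v. 0 \<le> v \<bullet> (matrix_of X *v v)}"

definition pd :: "'n::finite sym_matrix set" where
  "pd = {X. \<forall>v. v \<noteq> 0 \<longrightarrow> 0 < v \<bullet> (matrix_of X *v v)}"

definition psd_face :: "'n::finite sym_matrix set \<Rightarrow> bool" where
  "psd_face f \<longleftrightarrow> closed f \<and> convex_cone f \<and> f \<subseteq> psd \<and>
     (\<forall>X\<in>psd. \<forall>Y\<in>psd. X + Y \<in> f \<longrightarrow> X \<in> f \<and> Y \<in> f)"

definition proper_psd_face :: "'n::finite sym_matrix set \<Rightarrow> bool" where
  "proper_psd_face f \<longleftrightarrow> psd_face f \<and> f \<noteq> psd \<and> f \<noteq> {0}"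

definition feasible :: "('n::finite sym_matrix \<Rightarrow> real^'m::finite) \<Rightarrow> real^'m \<Rightarrow> 'n sym_matrix set" where
  "feasible \<A> b = {X \<in> psd. \<A> X = b}"

definition perturbed_rhs ::
    "('n::finite sym_matrix \<Rightarrow> real^'m::finite) \<Rightarrow> real^'m \<Rightarrow> real \<Rightarrow> real^'m" where
  "perturbed_rhs \<A> b \<alpha> = b + \<alpha> *\<^sub>R \<A> sym_id"

text \<open>Only the values on \<^const>\<open>psd\<close> matter, where the determinant is nonnegative and the second
  branch is exactly the singular case. The explicit case split is needed because \<^const>\<open>ln\<close>
  is total on the reals.\<close>

definition log_det :: "'n::finite sym_matrix \<Rightarrow> ereal" where
  "log_det X = (if 0 < det (matrix_of X) then ereal (ln (det (matrix_of X))) else -\<infinity>)"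

end

theory Submission
  imports Defs
begin

text \<open>
  Boundedness passes from \<open>\<F>\<close> to \<open>\<F>(\<alpha>)\<close> because both have the recession cone
  \<open>{D \<succeq> 0. \<A> D = 0}\<close>, and \<open>\<F>(\<alpha>)\<close> contains the positive definite matrix \<open>X + \<alpha> I\<close> for
  any \<open>X\<close> in \<open>\<F>\<close>. So the determinant attains a positive maximum on the compact set \<open>\<F>(\<alpha>)\<close>.
  Everything else is read off a simultaneous diagonalization
  \<open>X = C C\<^sup>T\<close>, \<open>H = C diag(\<mu>) C\<^sup>T\<close> of a positive definite \<open>X\<close> and a symmetric \<open>H\<close>: along the line
  \<open>X + t H\<close> the log-determinant is \<open>ln det X + \<Sum>i. ln (1 + t \<mu> i)\<close>, and \<open>\<langle>X\<^sup>-\<^sup>1, H\<rangle> = \<Sum>i. \<mu> i\<close>. Its derivative at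
  \<open>0\<close> vanishes for every \<open>H\<close> in the kernel of \<open>\<A>\<close> iff \<open>X\<^sup>-\<^sup>1\<close> lies in the range of \<open>\<A>\<^sup>*\<close>; the inequality
  \<open>ln (1 + \<mu>) \<le> \<mu>\<close>, with equality only for \<open>\<mu> = 0\<close>, gives sufficiency and uniqueness.
\<close>

section \<open>Spectral theorem for real symmetric matrices\<close>

text \<open>A quadratic in \<open>t\<close> that vanishes at \<open>0\<close> and is never negative
  has a minimum there, so its derivative \<open>2 * a\<close> at \<open>0\<close> is zero.\<close>

lemma linear_coefficient_zero:
  fixes a c :: real
  assumes "\<And>t. 0 \<le> 2 * t * a + t\<^sup>2 * c"
  shows "a = 0"
proof -
  have c: "0 \<le> c"
    using assms[of 1] assms[of "-1"] by simp
  \<comment> \<open>Dividing by \<open>c + 1\<close> instead of \<open>c\<close> covers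
    \<open>c = 0\<close>; at \<open>t = - a / k\<close> the quadratic is a negative multiple of
    \<open>a\<^sup>2\<close>.\<close>
  define k where "k = c + 1"
  have k: "0 < k" "c = k - 1"
    using c by (auto simp: k_def)
  have "0 \<le> 2 * (- a / k) * a + (- a / k)\<^sup>2 * c"
    by (rule assms)
  also have "\<dots> = - (a\<^sup>2 * (k + 1)) / k\<^sup>2"
    unfolding k(2) using k(1) by (simp add: field_simps power2_eq_square)
  finally have "a\<^sup>2 * (k + 1) \<le> 0"
    using k(1) by (auto simp: divide_le_0_iff)
  then show ?thesis
    using k(1) by (auto simp: mult_le_0_iff)
qed

text \<open>The vector \<open>v\<close> minimizes the form on \<open>S\<close>, so its first
  variation in any direction \<open>w\<close> of \<open>S\<close> vanishes: expand the form at
  \<open>v + t *\<^sub>R w\<close> as a quadratic in \<open>t\<close>.\<close>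

lemma nonneg_form_zero_imp_orthogonal:
  fixes h :: "'a::real_inner \<Rightarrow> 'a"
  assumes "linear h" and "subspace S"
    and sym: "\<And>x y. h x \<bullet> y = x \<bullet> h y"
    and nonneg: "\<And>x. x \<in> S \<Longrightarrow> 0 \<le> x \<bullet> h x"
    and "v \<in> S" "v \<bullet> h v = 0" "w \<in> S"
  shows "w \<bullet> h v = 0"
proof (rule linear_coefficient_zero)
  interpret linear h by fact
  fix t :: real
  have "0 \<le> (v + t *\<^sub>R w) \<bullet> h (v + t *\<^sub>R w)"
    using assms by (intro nonneg) (simp add: subspace_add subspace_scale)
  also have "\<dots> = 2 * t * (w \<bullet> h v) + t\<^sup>2 * (w \<bullet> h w)"
    using \<open>v \<bullet> h v = 0\<close> sym[of v w]
    by (simp add: add scale inner_add_left inner_add_right inner_commute power2_eq_square)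
  finally show "0 \<le> 2 * t * (w \<bullet> h v) + t\<^sup>2 * (w \<bullet> h w)" .
qed

text \<open>A maximizer of the Rayleigh quotient on the unit sphere of \<open>S\<close> is an
  eigenvector, with the maximum \<open>c\<close> as eigenvalue: the form of \<open>c I - f\<close>
  is nonnegative on \<open>S\<close> and vanishes at it.\<close>

lemma selfadjoint_eigenvector:
  fixes f :: "'a::euclidean_space \<Rightarrow> 'a"
  assumes lin: "linear f" and sub: "subspace S"
    and sym: "\<And>x y. f x \<bullet> y = x \<bullet> f y"
    and inv: "f ` S \<subseteq> S" and "S \<noteq> {0}"
  obtains v c where "v \<in> S" "norm v = 1" "f v = c *\<^sub>R v"
proof -
  interpret linear f by fact
  obtain u where u: "u \<in> S" "u \<noteq> 0"
    using assms(5) subspace_0[OF sub] by blast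
  have "u /\<^sub>R norm u \<in> sphere 0 1 \<inter> S"
    using u sub by (simp add: subspace_scale)
  moreover have "compact (sphere 0 1 \<inter> S)"
    by (simp add: compact_Int_closed closed_subspace sub)
  moreover have "continuous_on (sphere 0 1 \<inter> S) (\<lambda>x. x \<bullet> f x)"
    by (intro continuous_intros linear_continuous_on_compose[OF _ lin])
  ultimately obtain v where "v \<in> sphere 0 1 \<inter> S"
    and max: "\<And>x. x \<in> sphere 0 1 \<inter> S \<Longrightarrow> x \<bullet> f x \<le> v \<bullet> f v"
    using continuous_attains_sup[of "sphere 0 1 \<inter> S" "\<lambda>x. x \<bullet> f x"] by blast
  then have v: "v \<in> S" "norm v = 1"
    by simp_all
  define c where "c = v \<bullet> f v"
  define h where "h = (\<lambda>x. c *\<^sub>R x - f x)"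
  have lin_h: "linear h"
    unfolding h_def by (intro linear_compose_sub linear_scale_self lin)
  have sym_h: "h x \<bullet> y = x \<bullet> h y" for x y
    by (simp add: h_def inner_diff_left inner_diff_right sym)
  have nonneg: "0 \<le> x \<bullet> h x" if "x \<in> S" for x
  proof (cases "x = 0")
    case False
    have "(x /\<^sub>R norm x) \<bullet> f (x /\<^sub>R norm x) \<le> c"
      unfolding c_def using False that sub by (intro max) (simp add: subspace_scale)
    then have "x \<bullet> f x \<le> c * (norm x * norm x)"
      using False by (simp add: scale field_simps)
    then show ?thesis
      by (simp add: h_def inner_diff_right power2_norm_eq_inner[symmetric] power2_eq_square)
  qed simp
  have "v \<bullet> v = 1"
    using v by (simp add: norm_eq_1)
  then have "v \<bullet> h v = 0"
    by (simp add: h_def inner_diff_right c_def)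
  \<comment> \<open>Invariance of \<open>S\<close> lets \<open>h v\<close> itself serve as the test
    direction, so that \<open>h v\<close> is orthogonal to itself.\<close>
  moreover have "h v \<in> S"
    using v inv sub by (auto simp: h_def subspace_diff subspace_scale)
  ultimately have "h v \<bullet> h v = 0"
    using nonneg_form_zero_imp_orthogonal[OF lin_h sub sym_h nonneg v(1)] by blast
  then have "f v = c *\<^sub>R v"
    by (simp add: h_def)
  then show ?thesis
    using that v by blast
qed

text \<open>Induction on the dimension: split off one unit eigenvector; by self-adjointness its
  orthogonal complement within \<open>S\<close> is again invariant.\<close>

lemma selfadjoint_orthonormal_eigenbasis:
  fixes f :: "'a::euclidean_space \<Rightarrow> 'a"
  assumes lin: "linear f" and sym: "\<And>x y. f x \<bullet> y = x \<bullet> f y"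
    and "subspace S" and "f ` S \<subseteq> S"
  shows "\<exists>B. B \<subseteq> S \<and> span B = S \<and> pairwise orthogonal B \<and>
    (\<forall>v\<in>B. norm v = 1 \<and> (\<exists>c. f v = c *\<^sub>R v))"
  using assms(3,4)
proof (induction "dim S" arbitrary: S rule: less_induct)
  case less
  show ?case
  proof (cases "S = {0}")
    case True
    then show ?thesis
      by (intro exI[of _ "{}"]) auto
  next
    case False
    then obtain v c where v: "v \<in> S" "norm v = 1" "f v = c *\<^sub>R v"
      using selfadjoint_eigenvector[OF lin less.prems(1) sym less.prems(2)] by blast
    have vv: "v \<bullet> v = 1"
      using v by (simp add: norm_eq_1)
    define T where "T = {x \<in> S. x \<bullet> v = 0}"
    have subT: "subspace T"
      using less.prems(1) unfolding T_def subspace_def by (auto simp: inner_add_left)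
    have "f ` T \<subseteq> T"
      using less.prems(2) v(3) by (auto simp: T_def sym)
    have "span T \<subset> span S"
      unfolding span_eq_iff[THEN iffD2, OF subT] span_eq_iff[THEN iffD2, OF less.prems(1)]
      using v(1) vv by (force simp: T_def)
    then have "dim T < dim S"
      by (rule dim_psubset)
    then obtain B where B: "B \<subseteq> T" "span B = T" "pairwise orthogonal B"
        "\<forall>v\<in>B. norm v = 1 \<and> (\<exists>c. f v = c *\<^sub>R v)"
      using less.hyps[OF _ subT \<open>f ` T \<subseteq> T\<close>] by auto
    show ?thesis
    proof (intro exI[of _ "insert v B"] conjI)
      show sub: "insert v B \<subseteq> S"
        using v B(1) by (auto simp: T_def)
      show "span (insert v B) = S"
      proof
        show "span (insert v B) \<subseteq> S"
          using sub less.prems(1) by (rule span_minimal)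
        show "S \<subseteq> span (insert v B)"
        proof
          fix x assume "x \<in> S"
          then have "x - (x \<bullet> v) *\<^sub>R v \<in> span B"
            using v(1) vv less.prems(1) unfolding B(2)
            by (simp add: T_def subspace_diff subspace_scale inner_diff_left)
          then show "x \<in> span (insert v B)"
            by (auto simp: span_insert)
        qed
      qed
      show "pairwise orthogonal (insert v B)"
        using B(1,3) by (auto simp: pairwise_insert T_def orthogonal_def inner_commute)
      show "\<forall>v\<in>insert v B. norm v = 1 \<and> (\<exists>c. f v = c *\<^sub>R v)"
        using v B(4) by auto
    qed
  qed
qed

section \<open>Diagonal matrices and orthogonal diagonalization\<close>

definition diag :: "('n \<Rightarrow> 'a) \<Rightarrow> 'a::zero^'n^'n" where
  "diag d = (\<chi> i j. if i = j then d i else 0)"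

lemma diag_mult_vec: "diag d *v x = (\<chi> i. d i * x $ i)" for x :: "'a::semiring_1^'n::finite"
  by (simp add: diag_def matrix_vector_mult_def vec_eq_iff if_distrib[of "\<lambda>a. a * _"] cong: if_cong)

lemma matrix_mult_diag: "A ** diag d = (\<chi> i j. A $ i $ j * d j)"
  for A :: "'a::semiring_1^'n::finite^'m"
  by (simp add: diag_def matrix_matrix_mult_def vec_eq_iff if_distrib cong: if_cong)

lemma diag_mult_diag: "diag d ** diag e = diag (\<lambda>i. d i * e i)"
  for d :: "'n::finite \<Rightarrow> 'a::semiring_1"
  by (simp add: matrix_mult_diag) (simp add: diag_def vec_eq_iff)

lemma transpose_diag [simp]: "transpose (diag d) = diag d"
  by (auto simp: diag_def transpose_def vec_eq_iff)

lemma det_diag [simp]: "det (diag d) = (\<Prod>i\<in>UNIV. d i)" for d :: "'n::finite \<Rightarrow> 'a::comm_ring_1"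
  by (subst det_diagonal) (auto simp: diag_def)

lemma trace_diag [simp]: "trace (diag d) = (\<Sum>i\<in>UNIV. d i)"
  by (simp add: trace_def diag_def)

text \<open>The columns of \<open>U\<close> are an orthonormal eigenbasis of \<open>W\<close>, and
  \<open>d\<close> lists the eigenvalues in the same order.\<close>

lemma symmetric_matrix_diagonalization:
  fixes W :: "real^'n^'n::finite"
  assumes W: "transpose W = W"
  obtains U d where "orthogonal_matrix U" "W = U ** diag d ** transpose U"
proof -
  have "(W *v x) \<bullet> y = x \<bullet> (W *v y)" for x y
    by (metis W dot_lmul_matrix vector_transpose_matrix)
  then obtain B where B: "span B = UNIV" "pairwise orthogonal B"
      "\<forall>v\<in>B. norm v = 1 \<and> (\<exists>c. W *v v = c *\<^sub>R v)"
    using selfadjoint_orthonormal_eigenbasis[of "(*v) W" UNIV] by auto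
  have "0 \<notin> B"
    using B(3) by force
  then have ind: "independent B"
    using B(2) by (rule pairwise_orthogonal_independent[rotated])
  \<comment> \<open>The count allows the eigenvectors to be indexed by \<open>'n\<close> itself,
    which makes \<open>U\<close> square.\<close>
  then have "card B = CARD('n)"
    by (metis B(1) dim_UNIV dim_span_eq_card_independent DIM_cart DIM_real mult.right_neutral)
  then obtain e where e: "bij_betw e (UNIV :: 'n set) B"
    using finite_same_card_bij[of "UNIV :: 'n set" B] independent_imp_finite[OF ind] by auto
  obtain c where c: "\<And>v. v \<in> B \<Longrightarrow> W *v v = c v *\<^sub>R v"
    using B(3) by metis
  define U where "U = (\<chi> i j. e j $ i)"
  have col: "column j U = e j" for j
    by (simp add: U_def column_def)
  have eB: "e j \<in> B" for j
    using e by (auto simp: bij_betw_def)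
  have U: "orthogonal_matrix U"
    unfolding orthogonal_matrix_orthonormal_columns col
    using pairwiseD[OF B(2) eB eB] B(3) eB bij_betw_imp_inj_on[OF e] by (auto simp: inj_eq)
  have "(W ** U) $ i $ j = (W *v e j) $ i" for i j
    by (simp add: U_def matrix_matrix_mult_def matrix_vector_mult_def)
  then have "W ** U = U ** diag (\<lambda>j. c (e j))"
    by (simp add: vec_eq_iff c[OF eB] matrix_mult_diag U_def)
  then have "W = U ** diag (\<lambda>j. c (e j)) ** transpose U"
    by (metis U matrix_mul_assoc matrix_mul_rid orthogonal_matrix_def)
  then show ?thesis
    using that U by blast
qed

section \<open>Simultaneous diagonalization\<close>

text \<open>In the coordinates \<open>transpose C *v v\<close> the form is a weighted sum of
  squares, so for invertible \<open>C\<close> the signs of \<open>d\<close> decide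
  definiteness.\<close>

lemma form_congruence_diag:
  "v \<bullet> ((C ** diag d ** transpose C) *v v) = (\<Sum>i\<in>UNIV. d i * ((transpose C *v v) $ i)\<^sup>2)"
  for C :: "real^'n^'n::finite"
proof -
  have "v \<bullet> ((C ** diag d ** transpose C) *v v) = (transpose C *v v) \<bullet> (diag d *v (transpose C *v v))"
    by (simp add: dot_lmul_matrix flip: matrix_vector_mul_assoc)
  then show ?thesis
    by (simp add: diag_mult_vec inner_vec_def power2_eq_square ac_simps)
qed

lemma form_pos_imp_det_nonzero:
  fixes X :: "real^'n^'n::finite"
  assumes "\<And>v. v \<noteq> 0 \<Longrightarrow> 0 < v \<bullet> (X *v v)"
  shows "det X \<noteq> 0"
proof -
  have "X *v v = 0 \<Longrightarrow> v = 0" for v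
    using assms[of v] by force
  then show ?thesis
    by (meson invertible_det_nz invertible_left_inverse matrix_left_invertible_ker)
qed

text \<open>Write \<open>X = R ** transpose R\<close>, pull \<open>H\<close> back along the inverse
  \<open>S\<close> of \<open>R\<close>, and diagonalize the result by an orthogonal
  \<open>V\<close>. Then \<open>C = R ** V\<close> serves both matrices, since \<open>V\<close>
  cancels in \<open>C ** transpose C\<close>.\<close>

lemma simultaneous_diagonalization:
  fixes X H :: "real^'n^'n::finite"
  assumes X: "transpose X = X" "\<And>v. v \<noteq> 0 \<Longrightarrow> 0 < v \<bullet> (X *v v)"
    and H: "transpose H = H"
  obtains C :: "real^'n^'n" and \<mu> where "X = C ** transpose C" "H = C ** diag \<mu> ** transpose C"
proof -
  obtain U d where U: "orthogonal_matrix U" and XU: "X = U ** diag d ** transpose U"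
    using symmetric_matrix_diagonalization[OF X(1)] .
  have UtU: "transpose U ** U = mat 1"
    using U by (simp add: orthogonal_matrix)
  \<comment> \<open>The form of \<open>X\<close> at the \<open>i\<close>-th column of
    \<open>U\<close> is exactly \<open>d i\<close>.\<close>
  have d: "0 < d i" for i
  proof -
    have a: "transpose U *v (U *v axis i 1) = axis i 1"
      by (simp add: matrix_vector_mul_assoc UtU del: transpose_matrix_vector)
    then have "U *v axis i 1 \<noteq> 0"
      by (metis axis_eq_0_iff matrix_vector_mult_0_right zero_neq_one)
    then have "0 < (\<Sum>j\<in>UNIV. d j * ((axis i 1 :: real^'n) $ j)\<^sup>2)"
      using X(2)[of "U *v axis i 1"] unfolding XU form_congruence_diag a by simp
    then show ?thesis
      by (simp add: axis_def if_distrib[of "\<lambda>a. a\<^sup>2"] if_distrib[of "\<lambda>a. _ * a"] cong: if_cong)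
  qed
  define R where "R = U ** diag (\<lambda>i. sqrt (d i))"
  have XR: "X = R ** transpose R"
  proof -
    have "diag (\<lambda>i. sqrt (d i)) ** diag (\<lambda>i. sqrt (d i)) = diag d"
      using d by (simp add: diag_mult_diag less_imp_le)
    then show ?thesis
      unfolding R_def XU matrix_transpose_mul transpose_diag
      by (metis matrix_mul_assoc)
  qed
  then have "det R \<noteq> 0"
    using form_pos_imp_det_nonzero[OF X(2)] by (auto simp: det_mul)
  then obtain S where S: "R ** S = mat 1" "S ** R = mat 1"
    by (metis invertible_def invertible_det_nz)
  have "transpose (S ** H ** transpose S) = S ** H ** transpose S"
    by (simp add: matrix_transpose_mul H matrix_mul_assoc)
  then obtain V \<mu> where V: "orthogonal_matrix V"
      and SV: "S ** H ** transpose S = V ** diag \<mu> ** transpose V"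
    by (rule symmetric_matrix_diagonalization)
  have VVt: "V ** transpose V = mat 1"
    using V by (simp add: orthogonal_matrix_def)
  show ?thesis
  proof (rule that[of "R ** V" \<mu>])
    have "(R ** V) ** transpose (R ** V) = R ** (V ** transpose V) ** transpose R"
      by (simp only: matrix_transpose_mul matrix_mul_assoc)
    then show "X = (R ** V) ** transpose (R ** V)"
      by (simp add: VVt XR)
    have "transpose S ** transpose R = mat 1"
      by (simp add: S flip: matrix_transpose_mul)
    then have "H = (R ** S) ** H ** (transpose S ** transpose R)"
      by (simp add: S)
    also have "\<dots> = R ** (S ** H ** transpose S) ** transpose R"
      by (simp only: matrix_mul_assoc)
    also have "\<dots> = (R ** V) ** diag \<mu> ** transpose (R ** V)"
      by (simp only: SV matrix_transpose_mul matrix_mul_assoc)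
    finally show "H = (R ** V) ** diag \<mu> ** transpose (R ** V)" .
  qed
qed

section \<open>Definiteness and the sign of the determinant\<close>

lemma pd_subset_psd: "pd \<subseteq> psd"
proof
  fix X :: "'n::finite sym_matrix"
  assume X: "X \<in> pd"
  have "0 \<le> v \<bullet> (matrix_of X *v v)" for v
    using X by (cases "v = 0") (auto simp: pd_def less_imp_le)
  then show "X \<in> psd"
    by (simp add: psd_def)
qed

lemma det_pd_pos:
  fixes X :: "'n::finite sym_matrix"
  assumes "X \<in> pd"
  shows "0 < det (matrix_of X)"
proof -
  have pos: "0 < v \<bullet> (matrix_of X *v v)" if "v \<noteq> 0" for v
    using assms that by (simp add: pd_def)
  \<comment> \<open>Only the factorization of \<open>X\<close> matters here, so \<open>X\<close>
    also fills the place of \<open>H\<close>; the determinant becomes a square.\<close>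
  obtain C :: "real^'n^'n" where "matrix_of X = C ** transpose C"
    using simultaneous_diagonalization[OF transpose_matrix_of pos transpose_matrix_of[of X]] by blast
  then have "0 \<le> det (matrix_of X)"
    by (simp add: det_mul)
  moreover have "det (matrix_of X) \<noteq> 0"
    using pos by (rule form_pos_imp_det_nonzero)
  ultimately show ?thesis
    by simp
qed

text \<open>A zero of a positive semidefinite form lies in the kernel of its matrix, and an
  invertible matrix has trivial kernel.\<close>

lemma psd_det_pos_imp_pd:
  fixes X :: "'n::finite sym_matrix"
  assumes X: "X \<in> psd" and det: "0 < det (matrix_of X)"
  shows "X \<in> pd"
proof -
  have sym: "(matrix_of X *v x) \<bullet> y = x \<bullet> (matrix_of X *v y)" for x y
    by (metis transpose_matrix_of dot_lmul_matrix vector_transpose_matrix)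
  have "v \<bullet> (matrix_of X *v v) \<noteq> 0" if "v \<noteq> 0" for v
  proof
    assume zero: "v \<bullet> (matrix_of X *v v) = 0"
    have nonneg: "0 \<le> x \<bullet> (matrix_of X *v x)" for x
      using X by (simp add: psd_def)
    have "(matrix_of X *v v) \<bullet> (matrix_of X *v v) = 0"
      by (rule nonneg_form_zero_imp_orthogonal[OF matrix_vector_mul_linear subspace_UNIV sym nonneg
            UNIV_I zero UNIV_I])
    then have "matrix_of X *v v = 0"
      by simp
    moreover have "invertible (matrix_of X)"
      using det by (simp add: invertible_det_nz)
    ultimately show False
      using that by (metis invertible_left_inverse matrix_left_invertible_ker)
  qed
  then show ?thesis
    using X by (force simp: psd_def pd_def less_le)
qed

lemma matrix_add_rdistrib: "(A + B) ** C = A ** C + B ** C"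
  for A B :: "'a::semiring_1^'n::finite^'m"
  by (simp add: matrix_matrix_mult_def vec_eq_iff distrib_right sum.distrib)

text \<open>The \<open>\<mu> i\<close> are the eigenvalues of \<open>H\<close> relative to \<open>X\<close>.\<close>

lemma pd_line_eigenvalues:
  fixes X H :: "'n::finite sym_matrix"
  assumes X: "X \<in> pd"
  obtains \<mu> :: "'n \<Rightarrow> real" where
    "\<And>t. det (matrix_of (X + t *\<^sub>R H)) = det (matrix_of X) * (\<Prod>i\<in>UNIV. 1 + t * \<mu> i)"
    "\<And>t. X + t *\<^sub>R H \<in> pd \<longleftrightarrow> (\<forall>i. 0 < 1 + t * \<mu> i)"
    "\<And>Z. matrix_of Z ** matrix_of X = mat 1 \<Longrightarrow> Z \<bullet> H = (\<Sum>i\<in>UNIV. \<mu> i)"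
    "(\<And>i. \<mu> i = 0) \<Longrightarrow> H = 0"
proof -
  have pos: "0 < v \<bullet> (matrix_of X *v v)" if "v \<noteq> 0" for v
    using X that by (simp add: pd_def)
  obtain C :: "real^'n^'n" and \<mu> where XC: "matrix_of X = C ** transpose C"
      and HC: "matrix_of H = C ** diag \<mu> ** transpose C"
    using simultaneous_diagonalization[OF transpose_matrix_of pos transpose_matrix_of] by metis
  have line: "matrix_of (X + t *\<^sub>R H) = C ** diag (\<lambda>i. 1 + t * \<mu> i) ** transpose C" for t
  proof -
    have "diag (\<lambda>i. 1 + t * \<mu> i) = mat 1 + t *\<^sub>R diag \<mu>"
      by (simp add: diag_def mat_def vec_eq_iff)
    then show ?thesis
      by (simp add: plus_sym_matrix.rep_eq scaleR_sym_matrix.rep_eq XC HC matrix_add_ldistrib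
          matrix_add_rdistrib matrix_scalar_ac flip: scalar_matrix_assoc)
  qed
  have "det C \<noteq> 0"
    using det_pd_pos[OF X] by (auto simp: XC det_mul)
  then have "invertible (transpose C)"
    by (simp add: invertible_det_nz)
  then obtain S where S: "transpose C ** S = mat 1" "S ** transpose C = mat 1"
    by (auto simp: invertible_def)
  show ?thesis
  proof (rule that[of \<mu>])
    fix t :: real
    show "det (matrix_of (X + t *\<^sub>R H)) = det (matrix_of X) * (\<Prod>i\<in>UNIV. 1 + t * \<mu> i)"
      unfolding line by (simp add: XC det_mul)
    show "X + t *\<^sub>R H \<in> pd \<longleftrightarrow> (\<forall>i. 0 < 1 + t * \<mu> i)"
    proof
      assume pd: "X + t *\<^sub>R H \<in> pd"
      show "\<forall>i. 0 < 1 + t * \<mu> i"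
      proof
        fix i
        \<comment> \<open>The test vector \<open>S *v axis i 1\<close> isolates the
          \<open>i\<close>-th diagonal entry of the congruent form.\<close>
        have a: "transpose C *v (S *v axis i 1) = axis i 1"
          by (simp add: matrix_vector_mul_assoc S del: transpose_matrix_vector)
        then have "S *v axis i 1 \<noteq> 0"
          by (metis axis_eq_0_iff matrix_vector_mult_0_right zero_neq_one)
        then have "0 < (S *v axis i 1) \<bullet> (matrix_of (X + t *\<^sub>R H) *v (S *v axis i 1))"
          using pd by (simp add: pd_def)
        then have "0 < (\<Sum>j\<in>UNIV. (1 + t * \<mu> j) * ((axis i 1 :: real^'n) $ j)\<^sup>2)"
          unfolding line form_congruence_diag a .
        then show "0 < 1 + t * \<mu> i"
          by (simp add: axis_def if_distrib[of "\<lambda>a. a\<^sup>2"] if_distrib[of "\<lambda>a. _ * a"] cong: if_cong)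
      qed
    next
      assume \<mu>: "\<forall>i. 0 < 1 + t * \<mu> i"
      have "0 < v \<bullet> (matrix_of (X + t *\<^sub>R H) *v v)" if "v \<noteq> 0" for v
      proof -
        have "S *v (transpose C *v v) \<noteq> 0"
          using that by (simp add: matrix_vector_mul_assoc S del: transpose_matrix_vector)
        then have "transpose C *v v \<noteq> 0"
          by (metis matrix_vector_mult_0_right)
        then obtain i where "(transpose C *v v) $ i \<noteq> 0"
          by (metis vec_eq_iff zero_index)
        then show ?thesis
          unfolding line form_congruence_diag using \<mu>
          by (intro sum_pos2[of _ i]) (auto simp: less_imp_le simp del: transpose_matrix_vector)
      qed
      then show "X + t *\<^sub>R H \<in> pd"
        by (simp add: pd_def)
    qed
  next
    fix Z :: "'n sym_matrix"
    assume "matrix_of Z ** matrix_of X = mat 1"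
    then have "(matrix_of Z ** C) ** transpose C = mat 1"
      by (simp add: XC matrix_mul_assoc)
    \<comment> \<open>Since \<open>Z\<close> inverts \<open>C ** transpose C\<close>, its own
      congruence by \<open>C\<close> is the identity; cyclicity of the trace then leaves only the
      trace of \<open>diag \<mu>\<close>.\<close>
    then have Z: "transpose C ** (matrix_of Z ** C) = mat 1"
      by (simp only: matrix_left_right_inverse)
    have "Z \<bullet> H = trace ((matrix_of Z ** (C ** diag \<mu>)) ** transpose C)"
      by (simp add: inner_sym_matrix_def HC matrix_mul_assoc)
    also have "\<dots> = trace ((transpose C ** (matrix_of Z ** C)) ** diag \<mu>)"
      by (subst trace_mul_sym) (simp only: matrix_mul_assoc)
    also have "\<dots> = (\<Sum>i\<in>UNIV. \<mu> i)"
      by (simp add: Z)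
    finally show "Z \<bullet> H = (\<Sum>i\<in>UNIV. \<mu> i)" .
  next
    assume "\<And>i. \<mu> i = 0"
    then have "diag \<mu> = 0"
      by (simp add: diag_def vec_eq_iff)
    then have "matrix_of H = 0"
      by (simp add: HC)
    then show "H = 0"
      by (simp add: zero_sym_matrix.rep_eq flip: matrix_of_inject)
  qed
qed

section \<open>Gradient and strict concavity of the log-determinant\<close>

text \<open>\<open>Z\<close> is the inverse of \<open>X\<close>, the gradient of the log-determinant
  at \<open>X\<close>. The gap between tangent and function is the sum of the terms
  \<open>\<mu> i - ln (1 + \<mu> i)\<close>, each nonnegative and zero only for
  \<open>\<mu> i = 0\<close>.\<close>

lemma ln_det_gradient_inequality:
  fixes X Y Z :: "'n::finite sym_matrix"
  assumes X: "X \<in> pd" and Y: "Y \<in> pd" and Z: "matrix_of Z ** matrix_of X = mat 1"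
  shows "ln (det (matrix_of Y)) \<le> ln (det (matrix_of X)) + Z \<bullet> (Y - X)"
    and "ln (det (matrix_of Y)) = ln (det (matrix_of X)) + Z \<bullet> (Y - X) \<Longrightarrow> Y = X"
proof -
  obtain \<mu> :: "'n \<Rightarrow> real" where
    det: "\<And>t. det (matrix_of (X + t *\<^sub>R (Y - X))) = det (matrix_of X) * (\<Prod>i\<in>UNIV. 1 + t * \<mu> i)"
    and pd: "\<And>t. X + t *\<^sub>R (Y - X) \<in> pd \<longleftrightarrow> (\<forall>i. 0 < 1 + t * \<mu> i)"
    and tr: "\<And>Z. matrix_of Z ** matrix_of X = mat 1 \<Longrightarrow> Z \<bullet> (Y - X) = (\<Sum>i\<in>UNIV. \<mu> i)"
    and zero: "(\<And>i. \<mu> i = 0) \<Longrightarrow> Y - X = 0"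
    using pd_line_eigenvalues[OF X] by blast
  have \<mu>: "0 < 1 + \<mu> i" for i
    using pd[of 1] Y by simp
  have "ln (det (matrix_of Y)) = ln (det (matrix_of X)) + (\<Sum>i\<in>UNIV. ln (1 + \<mu> i))"
    using det[of 1] det_pd_pos[OF X] \<mu>
    by (simp add: ln_mult prod_pos ln_prod less_imp_neq[THEN not_sym])
  then have gap: "ln (det (matrix_of X)) + Z \<bullet> (Y - X) - ln (det (matrix_of Y))
      = (\<Sum>i\<in>UNIV. \<mu> i - ln (1 + \<mu> i))"
    by (simp add: tr[OF Z] sum_subtractf)
  have nonneg: "0 \<le> \<mu> i - ln (1 + \<mu> i)" for i
    using ln_le_minus_one[OF \<mu>[of i]] by simp
  then show "ln (det (matrix_of Y)) \<le> ln (det (matrix_of X)) + Z \<bullet> (Y - X)"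
    using gap sum_nonneg[of UNIV "\<lambda>i. \<mu> i - ln (1 + \<mu> i)"] by simp
  assume "ln (det (matrix_of Y)) = ln (det (matrix_of X)) + Z \<bullet> (Y - X)"
  then have "\<mu> i - ln (1 + \<mu> i) = 0" for i
    using gap nonneg by (simp add: sum_nonneg_eq_0_iff)
  then have "\<mu> i = 0" for i
    using ln_eq_minus_one[OF \<mu>[of i]] by simp
  then show "Y = X"
    using zero by simp
qed

text \<open>First-order condition: \<open>Z \<bullet> H\<close> is the derivative at
  \<open>0\<close> of the log-determinant along \<open>X + t *\<^sub>R H\<close>, and
  \<open>t\<close> may take either sign.\<close>

lemma det_local_max_imp_gradient_orthogonal:
  fixes X Z H :: "'n::finite sym_matrix"
  assumes X: "X \<in> pd" and Z: "matrix_of Z ** matrix_of X = mat 1"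
    and max: "\<And>t. X + t *\<^sub>R H \<in> pd \<Longrightarrow> det (matrix_of (X + t *\<^sub>R H)) \<le> det (matrix_of X)"
  shows "Z \<bullet> H = 0"
proof -
  obtain \<mu> :: "'n \<Rightarrow> real" where
    det: "\<And>t. det (matrix_of (X + t *\<^sub>R H)) = det (matrix_of X) * (\<Prod>i\<in>UNIV. 1 + t * \<mu> i)"
    and pd: "\<And>t. X + t *\<^sub>R H \<in> pd \<longleftrightarrow> (\<forall>i. 0 < 1 + t * \<mu> i)"
    and tr: "\<And>Z. matrix_of Z ** matrix_of X = mat 1 \<Longrightarrow> Z \<bullet> H = (\<Sum>i\<in>UNIV. \<mu> i)"
    using pd_line_eigenvalues[OF X] by metis
  let ?g = "\<lambda>t. \<Sum>i\<in>UNIV. ln (1 + t * \<mu> i)"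
  \<comment> \<open>\<open>s\<close> bounds every \<open>\<bar>\<mu> i\<bar>\<close>, so the line
    stays in \<open>pd\<close> for \<open>\<bar>t\<bar> < 1 / s\<close>; the summand
    \<open>1\<close> keeps \<open>s\<close> positive when all \<open>\<mu> i\<close> vanish.\<close>
  define s where "s = 1 + (\<Sum>i\<in>UNIV. \<bar>\<mu> i\<bar>)"
  have s: "0 < s" "\<bar>\<mu> i\<bar> < s" for i
    using member_le_sum[of i UNIV "\<lambda>i. \<bar>\<mu> i\<bar>"] sum_nonneg[of UNIV "\<lambda>i. \<bar>\<mu> i\<bar>"]
    by (simp_all add: s_def)
  have pos: "0 < 1 + t * \<mu> i" if "\<bar>t\<bar> < 1 / s" for t i
  proof -
    have "\<bar>t * \<mu> i\<bar> \<le> \<bar>t\<bar> * s"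
      unfolding abs_mult using s(2)[of i] by (intro mult_left_mono) auto
    also have "\<dots> < 1"
      using that s(1) by (simp add: field_simps)
    finally show ?thesis
      by simp
  qed
  have "(?g has_real_derivative (\<Sum>i\<in>UNIV. \<mu> i)) (at 0)"
    by (auto intro!: derivative_eq_intros)
  then have "(\<Sum>i\<in>UNIV. \<mu> i) = 0"
  proof (rule DERIV_local_max)
    show "0 < 1 / s"
      using s by simp
    show "\<forall>t. \<bar>0 - t\<bar> < 1 / s \<longrightarrow> ?g t \<le> ?g 0"
    proof (intro allI impI)
      fix t :: real
      assume "\<bar>0 - t\<bar> < 1 / s"
      then have p: "0 < 1 + t * \<mu> i" for i
        by (intro pos) simp
      then have "(\<Prod>i\<in>UNIV. 1 + t * \<mu> i) \<le> 1"
        using max[of t] det_pd_pos[OF X] by (simp add: det pd)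
      moreover have "?g t = ln (\<Prod>i\<in>UNIV. 1 + t * \<mu> i)"
        using p by (simp add: ln_prod less_imp_neq[THEN not_sym])
      ultimately show "?g t \<le> ?g 0"
        using p by (simp add: prod_pos)
    qed
  qed
  then show ?thesis
    by (simp add: tr[OF Z])
qed

text \<open>The transpose of the inverse \<open>W\<close> is again an inverse of \<open>X\<close>,
  so \<open>W\<close> is symmetric; the form of \<open>W\<close> at \<open>v\<close> equals that of
  \<open>X\<close> at \<open>W *v v\<close>.\<close>

lemma pd_inverse:
  assumes X: "X \<in> pd"
  obtains Z where "Z \<in> pd" "matrix_of Z ** matrix_of X = mat 1"
proof -
  have "invertible (matrix_of X)"
    using det_pd_pos[OF X] by (simp add: invertible_det_nz)
  then obtain W where W: "matrix_of X ** W = mat 1" "W ** matrix_of X = mat 1"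
    by (auto simp: invertible_def)
  have "transpose W ** matrix_of X = mat 1"
    by (metis W(1) matrix_transpose_mul transpose_mat transpose_matrix_of)
  then have "transpose W = W"
    by (metis W(1) matrix_mul_assoc matrix_mul_lid matrix_mul_rid)
  then have rep: "matrix_of (Sym W) = W"
    by (simp add: Sym_inverse)
  have "0 < v \<bullet> (W *v v)" if "v \<noteq> 0" for v
  proof -
    have v: "matrix_of X *v (W *v v) = v"
      by (simp add: matrix_vector_mul_assoc W)
    then have "W *v v \<noteq> 0"
      using that by (metis matrix_vector_mult_0_right)
    then have "0 < (W *v v) \<bullet> (matrix_of X *v (W *v v))"
      using X by (simp add: pd_def)
    then show ?thesis
      unfolding v by (simp add: inner_commute)
  qed
  then have "Sym W \<in> pd"
    by (simp add: pd_def rep)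
  then show ?thesis
    using that W rep by auto
qed

lemma left_inverse_pd_imp_pd:
  assumes Z: "Z \<in> pd" and ZX: "matrix_of Z ** matrix_of X = mat 1"
  shows "X \<in> pd"
proof -
  obtain W where W: "W \<in> pd" "matrix_of W ** matrix_of Z = mat 1"
    using pd_inverse[OF Z] .
  then have "matrix_of W = matrix_of X"
    by (metis ZX matrix_mul_assoc matrix_mul_lid matrix_mul_rid)
  then show ?thesis
    using W by (simp add: matrix_of_inject)
qed

section \<open>Compactness of the feasible sets\<close>

lemma linear_matrix_of: "linear matrix_of"
  by (rule linearI) (simp_all add: plus_sym_matrix.rep_eq scaleR_sym_matrix.rep_eq)

lemma continuous_on_matrix_of [continuous_intros]:
  "continuous_on S f \<Longrightarrow> continuous_on S (\<lambda>x. matrix_of (f x))"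
  using linear_matrix_of unfolding linear_conv_bounded_linear by (rule bounded_linear.continuous_on)

lemma continuous_on_det_matrix_of: "continuous_on S (\<lambda>X. det (matrix_of X))"
  unfolding det_def by (intro continuous_intros)

lemma closed_psd: "closed (psd :: 'n::finite sym_matrix set)"
proof -
  have eq: "psd = (\<Inter>v. {X :: 'n sym_matrix. 0 \<le> v \<bullet> (matrix_of X *v v)})"
    by (auto simp: psd_def)
  have "closed {X. 0 \<le> v \<bullet> (matrix_of X *v v)}" for v :: "real^'n"
    unfolding matrix_vector_mult_def inner_vec_def
    by (intro closed_Collect_le continuous_intros)
  then show ?thesis
    unfolding eq by (intro closed_INT ballI)
qed

lemma psd_add: "X \<in> psd \<Longrightarrow> Y \<in> psd \<Longrightarrow> X + Y \<in> psd"
  by (simp add: psd_def plus_sym_matrix.rep_eq matrix_vector_mult_add_rdistrib inner_add_right)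

lemma psd_scaleR: "X \<in> psd \<Longrightarrow> 0 \<le> t \<Longrightarrow> t *\<^sub>R X \<in> psd"
  by (simp add: psd_def scaleR_sym_matrix.rep_eq flip: scaleR_matrix_vector_assoc)

lemma psd_add_scaled_id_pd:
  assumes "X \<in> psd" "0 < t"
  shows "X + t *\<^sub>R sym_id \<in> pd"
  using assms
  by (simp add: psd_def pd_def plus_sym_matrix.rep_eq scaleR_sym_matrix.rep_eq sym_id.rep_eq
      matrix_vector_mult_add_rdistrib inner_add_right add_nonneg_pos flip: scaleR_matrix_vector_assoc)

text \<open>A nonzero \<open>D\<close> would be a recession direction: the whole ray from a feasible
  \<open>X\<close> along \<open>D\<close> would stay feasible.\<close>

lemma feasible_recession_trivial:
  assumes lin: "linear \<A>" and ne: "feasible \<A> b \<noteq> {}" and bdd: "bounded (feasible \<A> b)"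
    and D: "D \<in> psd" "\<A> D = 0"
  shows "D = 0"
proof (rule ccontr)
  assume "D \<noteq> 0"
  obtain X where X: "X \<in> feasible \<A> b"
    using ne by blast
  obtain M where M: "\<And>Y. Y \<in> feasible \<A> b \<Longrightarrow> norm Y \<le> M"
    using bdd unfolding bounded_iff by blast
  have M0: "0 \<le> M"
    using M[OF X] norm_ge_zero[of X] by linarith
  \<comment> \<open>The step has length \<open>2 * M + 1\<close>, more than the distance
    \<open>2 * M\<close> possible between two points of norm at most \<open>M\<close>.\<close>
  define t where "t = (2 * M + 1) / norm D"
  have "X + t *\<^sub>R D \<in> feasible \<A> b"
    using X D M0 lin
    by (auto simp: feasible_def t_def linear_add linear_scale intro!: psd_add psd_scaleR)
  then have "norm (X + t *\<^sub>R D) \<le> M"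
    by (rule M)
  moreover have "norm (t *\<^sub>R D) = 2 * M + 1"
    using \<open>D \<noteq> 0\<close> M0 by (simp add: t_def)
  ultimately show False
    using M[OF X] norm_triangle_ineq4[of "X + t *\<^sub>R D" X] by simp
qed

text \<open>The recession cone does not depend on the right-hand side, so boundedness for
  \<open>b\<close> carries over to every \<open>c\<close>. Quantitatively,
  \<open>norm (\<A> D)\<close> has a positive lower bound \<open>r\<close> on the unit sphere of
  \<open>psd\<close>, which gives \<open>norm X \<le> norm c / r\<close>.\<close>

lemma compact_feasible:
  fixes \<A> :: "'n::finite sym_matrix \<Rightarrow> real^'m::finite"
  assumes lin: "linear \<A>" and ne: "feasible \<A> b \<noteq> {}" and bdd: "bounded (feasible \<A> b)"
  shows "compact (feasible \<A> c)"
proof -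
  have cont: "continuous_on S \<A>" for S
    by (simp add: lin linear_continuous_on linear_linear)
  let ?K = "sphere 0 1 \<inter> psd :: 'n sym_matrix set"
  have "compact ?K"
    by (simp add: compact_Int_closed closed_psd)
  have "\<exists>r>0. \<forall>D\<in>?K. r \<le> norm (\<A> D)"
  proof (cases "?K = {}")
    case True
    show ?thesis
      unfolding True by (intro exI[of _ 1]) simp
  next
    case False
    then obtain E where E: "E \<in> ?K" "\<And>D. D \<in> ?K \<Longrightarrow> norm (\<A> E) \<le> norm (\<A> D)"
      using continuous_attains_inf[OF \<open>compact ?K\<close> _ continuous_on_norm[OF cont]] by blast
    \<comment> \<open>Otherwise the unit vector \<open>E\<close> would be a nontrivial recession
      direction.\<close>
    have "\<A> E \<noteq> 0"
      using feasible_recession_trivial[OF lin ne bdd] E(1) by force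
    then show ?thesis
      using E(2) by (intro exI[of _ "norm (\<A> E)"]) simp
  qed
  then obtain r where r: "0 < r" "\<And>D. D \<in> ?K \<Longrightarrow> r \<le> norm (\<A> D)"
    by blast
  have "norm X \<le> norm c / r" if X: "X \<in> feasible \<A> c" for X
  proof (cases "X = 0")
    case False
    have "r \<le> norm (\<A> (X /\<^sub>R norm X))"
      using X False by (intro r(2)) (simp add: feasible_def psd_scaleR)
    then show ?thesis
      using X False r(1) lin by (simp add: linear_scale feasible_def field_simps)
  qed (use r in simp)
  then have "bounded (feasible \<A> c)"
    by (auto simp: bounded_iff)
  moreover have "feasible \<A> c = psd \<inter> {X. \<A> X = c}"
    by (auto simp: feasible_def)
  then have "closed (feasible \<A> c)"
    by (simp add: closed_Int closed_psd closed_Collect_eq cont)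
  ultimately show ?thesis
    by (simp add: compact_eq_bounded_closed)
qed

section \<open>Maximizers of the log-determinant\<close>

text \<open>A competitor with positive determinant keeps a maximizer off the value
  \<open>-\<infinity>\<close>; on positive determinants \<open>ln\<close> is strictly increasing, so
  the real-valued determinant can be maximized instead.\<close>

lemma is_arg_max_log_det_iff:
  assumes "P X0" and X0: "0 < det (matrix_of X0)"
  shows "is_arg_max log_det P X \<longleftrightarrow>
    P X \<and> 0 < det (matrix_of X) \<and> (\<forall>Y. P Y \<longrightarrow> det (matrix_of Y) \<le> det (matrix_of X))"
    (is "?L \<longleftrightarrow> ?R")
proof
  assume L: ?L
  have pos: "0 < det (matrix_of X)"
  proof (rule ccontr)
    assume "\<not> 0 < det (matrix_of X)"
    then have "log_det X < log_det X0"
      using X0 by (simp add: log_det_def)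
    then show False
      using L \<open>P X0\<close> by (auto simp: is_arg_max_def)
  qed
  have "det (matrix_of Y) \<le> det (matrix_of X)" if "P Y" for Y
  proof (cases "0 < det (matrix_of Y)")
    case True
    have "\<not> log_det X < log_det Y"
      using L that by (auto simp: is_arg_max_def)
    then show ?thesis
      using True pos by (simp add: log_det_def)
  qed (use pos in simp)
  then show ?R
    using L pos by (simp add: is_arg_max_def)
next
  assume R: ?R
  have "\<not> log_det X < log_det Y" if "P Y" for Y
    using R that by (simp add: log_det_def not_less)
  then show ?L
    using R by (auto simp: is_arg_max_def)
qed

text \<open>The range of the adjoint is the orthogonal complement of the kernel. This produces the
  Lagrange multiplier.\<close>

lemma range_adjoint_iff:
  fixes f :: "'a::euclidean_space \<Rightarrow> 'b::euclidean_space"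
  assumes "linear f"
  shows "z \<in> range (adjoint f) \<longleftrightarrow> (\<forall>x. f x = 0 \<longrightarrow> z \<bullet> x = 0)"
proof -
  have "subspace (range (adjoint f))"
    by (simp add: adjoint_linear[OF assms] linear_subspace_image)
  then have "range (adjoint f) = (f -` {0})\<^sup>\<bottom>"
    by (simp add: ker_orthogonal_comp_adjoint[OF assms] orthogonal_comp_self)
  then show ?thesis
    by (auto simp: orthogonal_comp_def orthogonal_def inner_commute)
qed

text \<open>Optimality conditions, with \<open>Z\<close> the inverse of \<open>X\<close>. At a
  maximizer the gradient \<open>Z\<close> is orthogonal to the kernel of \<open>\<A>\<close>, hence
  in the range of the adjoint. Conversely, concavity makes a stationary point a global
  maximizer.\<close>

lemma det_maximizer_iff_multiplier:
  fixes \<A> :: "'n::finite sym_matrix \<Rightarrow> real^'m::finite"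
  assumes lin: "linear \<A>"
  shows "(X \<in> feasible \<A> c \<and> 0 < det (matrix_of X) \<and>
      (\<forall>Y\<in>feasible \<A> c. det (matrix_of Y) \<le> det (matrix_of X))) \<longleftrightarrow>
    (\<exists>y Z. Z \<in> pd \<and> adjoint \<A> y = Z \<and> \<A> X = c \<and> matrix_of Z ** matrix_of X = mat 1)"
    (is "?L \<longleftrightarrow> ?R")
proof
  assume L: ?L
  then have X: "X \<in> pd" and AX: "\<A> X = c"
    by (auto simp: feasible_def intro: psd_det_pos_imp_pd)
  obtain Z where Z: "Z \<in> pd" "matrix_of Z ** matrix_of X = mat 1"
    using pd_inverse[OF X] .
  have "Z \<bullet> H = 0" if "\<A> H = 0" for H
  proof (rule det_local_max_imp_gradient_orthogonal[OF X Z(2)])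
    fix t
    assume "X + t *\<^sub>R H \<in> pd"
    then have "X + t *\<^sub>R H \<in> feasible \<A> c"
      using pd_subset_psd lin AX that by (auto simp: feasible_def linear_add linear_scale)
    then show "det (matrix_of (X + t *\<^sub>R H)) \<le> det (matrix_of X)"
      using L by blast
  qed
  then have "Z \<in> range (adjoint \<A>)"
    by (simp add: range_adjoint_iff[OF lin])
  then show ?R
    using Z AX by blast
next
  assume ?R
  then obtain y Z where Z: "Z \<in> pd" "adjoint \<A> y = Z" "\<A> X = c"
      "matrix_of Z ** matrix_of X = mat 1"
    by blast
  have X: "X \<in> pd"
    using Z by (blast intro: left_inverse_pd_imp_pd)
  have detX: "0 < det (matrix_of X)"
    by (rule det_pd_pos[OF X])
  have "det (matrix_of Y) \<le> det (matrix_of X)" if Y: "Y \<in> feasible \<A> c" for Y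
  proof (cases "0 < det (matrix_of Y)")
    case True
    then have "Y \<in> pd"
      using Y by (simp add: feasible_def psd_det_pos_imp_pd)
    \<comment> \<open>\<open>Y - X\<close> lies in the kernel of \<open>\<A>\<close>, so the linear
      term of the gradient inequality drops out.\<close>
    moreover have "Z \<bullet> (Y - X) = 0"
      using Y Z range_adjoint_iff[OF lin, of Z] by (auto simp: feasible_def linear_diff[OF lin])
    ultimately show ?thesis
      using ln_det_gradient_inequality(1)[OF X _ Z(4), of Y] True detX by simp
  qed (use detX in simp)
  then show ?L
    using X Z(3) detX pd_subset_psd by (auto simp: feasible_def)
qed

theorem theorem3p4:
  fixes \<A> :: "'n::finite sym_matrix \<Rightarrow> real^'m::finite"
    and b :: "real^'m"
  assumes "linear \<A>" and "surj \<A>"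
    and "feasible \<A> b \<noteq> {}"
    and "bounded (feasible \<A> b)"
    and "\<exists>f. proper_psd_face f \<and> feasible \<A> b \<subseteq> f"
  shows "\<forall>\<alpha>>0.
    (\<exists>!X. X \<in> feasible \<A> (perturbed_rhs \<A> b \<alpha>) \<inter> pd \<and>
          is_arg_max log_det (\<lambda>Y. Y \<in> feasible \<A> (perturbed_rhs \<A> b \<alpha>)) X) \<and>
    (\<forall>X. is_arg_max log_det (\<lambda>Y. Y \<in> feasible \<A> (perturbed_rhs \<A> b \<alpha>)) X \<longleftrightarrow>
         (\<exists>!(y, Z). Z \<in> pd \<and>
            adjoint \<A> y - Z = 0 \<and>
            \<A> X - perturbed_rhs \<A> b \<alpha> = 0 \<and>
            matrix_of Z ** matrix_of X - mat 1 = 0))"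
proof (intro allI impI)
  fix \<alpha> :: real
  assume \<alpha>: "0 < \<alpha>"
  define c where "c = perturbed_rhs \<A> b \<alpha>"
  let ?max = "\<lambda>X. X \<in> feasible \<A> c \<and> 0 < det (matrix_of X) \<and>
      (\<forall>Y\<in>feasible \<A> c. det (matrix_of Y) \<le> det (matrix_of X))"
  obtain X0 where X0: "X0 \<in> psd" "\<A> X0 = b"
    using assms(3) unfolding feasible_def by blast
  have pd1: "X0 + \<alpha> *\<^sub>R sym_id \<in> pd"
    using X0(1) \<alpha> by (rule psd_add_scaled_id_pd)
  \<comment> \<open>The shift of the right-hand side by
    \<open>\<alpha> *\<^sub>R \<A> sym_id\<close> is exactly what makes this positive definite point
    feasible.\<close>
  then have feas1: "X0 + \<alpha> *\<^sub>R sym_id \<in> feasible \<A> c"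
    using X0(2) subsetD[OF pd_subset_psd]
    by (simp add: feasible_def c_def perturbed_rhs_def linear_add[OF assms(1)] linear_scale[OF assms(1)])
  have argmax: "is_arg_max log_det (\<lambda>Y. Y \<in> feasible \<A> c) X \<longleftrightarrow> ?max X" for X
    using is_arg_max_log_det_iff[where P = "\<lambda>Y. Y \<in> feasible \<A> c", OF feas1 det_pd_pos[OF pd1]]
    by (simp add: Ball_def)
  have max_pd: "X \<in> pd" if "?max X" for X
    using that psd_det_pos_imp_pd unfolding feasible_def by blast
  \<comment> \<open>Surjectivity of \<open>\<A>\<close> enters here; it makes the multiplier
    \<open>y\<close> unique.\<close>
  have inj: "inj (adjoint \<A>)"
    using inj_adjoint_iff_surj[OF assms(1)] assms(2) by blast
  have ex: "\<exists>X. ?max X"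
  proof -
    obtain X where X: "X \<in> feasible \<A> c"
        "\<And>Y. Y \<in> feasible \<A> c \<Longrightarrow> det (matrix_of Y) \<le> det (matrix_of X)"
      using continuous_attains_sup[OF compact_feasible[OF assms(1,3,4), of c] _ continuous_on_det_matrix_of]
        feas1 by blast
    then show ?thesis
      using X(2)[OF feas1] det_pd_pos[OF pd1] by force
  qed
  \<comment> \<open>Two maximizers have equal determinants and differ by a kernel element, which is
    the equality case of the gradient inequality.\<close>
  have unique: "X = Y" if X: "?max X" and Y: "?max Y" for X Y
  proof -
    obtain y Z where Z: "adjoint \<A> y = Z" "matrix_of Z ** matrix_of X = mat 1"
      using X det_maximizer_iff_multiplier[OF assms(1)] by blast
    have "\<A> (Y - X) = 0"
      using X Y by (simp add: feasible_def linear_diff[OF assms(1)])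
    then have "Z \<bullet> (Y - X) = 0"
      using Z(1) range_adjoint_iff[OF assms(1), of Z] by blast
    moreover have "det (matrix_of Y) = det (matrix_of X)"
      using X Y by (meson order_antisym)
    ultimately show ?thesis
      using ln_det_gradient_inequality(2)[OF max_pd[OF X] max_pd[OF Y] Z(2)] by simp
  qed
  have "\<exists>!X. X \<in> feasible \<A> c \<inter> pd \<and> is_arg_max log_det (\<lambda>Y. Y \<in> feasible \<A> c) X"
  proof -
    obtain X where X: "?max X"
      using ex by blast
    show ?thesis
      unfolding argmax
    proof (rule ex1I[of _ X])
      show "X \<in> feasible \<A> c \<inter> pd \<and> ?max X"
        using X max_pd[OF X] by blast
      show "Y = X" if "Y \<in> feasible \<A> c \<inter> pd \<and> ?max Y" for Y
        using unique[OF conjunct2[OF that] X] .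
    qed
  qed
  moreover have "is_arg_max log_det (\<lambda>Y. Y \<in> feasible \<A> c) X \<longleftrightarrow>
      (\<exists>!(y, Z). Z \<in> pd \<and> adjoint \<A> y - Z = 0 \<and> \<A> X - c = 0 \<and>
        matrix_of Z ** matrix_of X - mat 1 = 0)" for X
  proof -
    have "(\<exists>!(y, Z). Z \<in> pd \<and> adjoint \<A> y = Z \<and> \<A> X = c \<and> matrix_of Z ** matrix_of X = mat 1) \<longleftrightarrow>
        (\<exists>y Z. Z \<in> pd \<and> adjoint \<A> y = Z \<and> \<A> X = c \<and> matrix_of Z ** matrix_of X = mat 1)"
      (is "?U \<longleftrightarrow> ?E")
    proof
      assume ?E
      then obtain y Z where Z: "Z \<in> pd" "adjoint \<A> y = Z" "\<A> X = c"
          "matrix_of Z ** matrix_of X = mat 1"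
        by blast
      \<comment> \<open>\<open>Z\<close> is determined as the inverse of \<open>X\<close>, and then
        \<open>y\<close> by injectivity of the adjoint; existence of the pair thus already gives
        uniqueness.\<close>
      have "y' = y \<and> adjoint \<A> y' = Z" if "matrix_of (adjoint \<A> y') ** matrix_of X = mat 1" for y'
      proof -
        have "matrix_of (adjoint \<A> y') = matrix_of Z"
          using that Z(4) by (metis matrix_left_right_inverse matrix_mul_assoc matrix_mul_lid matrix_mul_rid)
        then have "adjoint \<A> y' = Z"
          by (simp add: matrix_of_inject)
        then show ?thesis
          using Z(2) injD[OF inj, of y' y] by simp
      qed
      then show ?U
        using Z by (intro ex1I[of _ "(y, Z)"]) auto
    qed auto
    then show ?thesis
      unfolding argmax det_maximizer_iff_multiplier[OF assms(1)] by simp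
  qed
  ultimately show "(\<exists>!X. X \<in> feasible \<A> (perturbed_rhs \<A> b \<alpha>) \<inter> pd \<and>
          is_arg_max log_det (\<lambda>Y. Y \<in> feasible \<A> (perturbed_rhs \<A> b \<alpha>)) X) \<and>
    (\<forall>X. is_arg_max log_det (\<lambda>Y. Y \<in> feasible \<A> (perturbed_rhs \<A> b \<alpha>)) X \<longleftrightarrow>
         (\<exists>!(y, Z). Z \<in> pd \<and>
            adjoint \<A> y - Z = 0 \<and>
            \<A> X - perturbed_rhs \<A> b \<alpha> = 0 \<and>
            matrix_of Z ** matrix_of X - mat 1 = 0))"
    unfolding c_def by (intro conjI allI)
qed

end
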